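(* Let $f:(0,\infty)\to(0,\infty)$ be differentiable, let $\Psi[f](s)=-f'(s)/f(s)$, $s>0$, and assume that $\Psi[f]\in\mathcal S_1$ and that $\gamma:=\lim_{s\to\infty}s\,\Psi[f](s)<\infty$. Then for every $\alpha>0$, $f^\alpha\in\mathcal S_{\gamma\alpha}$. Moreover, if $f^\alpha=a+S_{\gamma\alpha}[\mu]$ is the Stieltjes representation of $f^\alpha$ (with $a\ge0$, $\mu\in\mathcal M^+_{\gamma\alpha}(\mathbb R_+)$), then $\mu$ has no singular continuous part.
   Context: $\mathbb R_+=[0,\infty)$. For $\alpha\ge0$, $\mathcal M^+_\alpha(\mathbb R_+)$ is the set of positive Borel measures $\mu$ on $\mathbb R_+$ with $\int_{\mathbb R_+}(1+t)^{-\alpha}\mu(dt)<\infty$, and for $\alpha>0$, $S_\alpha[\mu](z)=\int_{\mathbb R_+}\frac{\mu(dt)}{(z+t)^\alpha}$. For $\alpha>0$, $\mathcal S_\alpha$ is the class of functions $f:(0,\infty)\to[0,\infty)$ of the form $f=a+S_\alpha[\mu]$ with $a\ge0$ and $\mu\in\mathcal M^+_\alpha(\mathbb R_+)$ (generalized Stieltjes functions of order $\alpha$); the pair $(a,\mu)$ is uniquely determined by $f$ and called its Stieltjes representation. *)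

theory Defs
  imports "HOL-Analysis.Analysis"
begin

text \<open>Positive Borel measures on \<open>R_+ = [0,\<infinity>)\<close>, represented as Borel measures on the
  real line giving zero mass to \<open>(-\<infinity>,0)\<close>, with \<open>\<integral>(1+t)^(-\<alpha>) \<mu>(dt) < \<infinity>\<close>.\<close>
definition M_plus :: "real \<Rightarrow> real measure set" where
  "M_plus \<alpha> = {\<mu>. sets \<mu> = sets borel \<and> emeasure \<mu> {..<0} = 0 \<and>
      (\<integral>\<^sup>+ t. ennreal ((1 + t) powr (- \<alpha>)) \<partial>\<mu>) < \<infinity>}"

definition S_transform :: "real \<Rightarrow> real measure \<Rightarrow> real \<Rightarrow> ennreal" where
  "S_transform \<alpha> \<mu> z = (\<integral>\<^sup>+ t. ennreal ((z + t) powr (- \<alpha>)) \<partial>\<mu>)"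

definition stieltjes_rep :: "real \<Rightarrow> real \<Rightarrow> real measure \<Rightarrow> (real \<Rightarrow> real) \<Rightarrow> bool" where
  "stieltjes_rep \<alpha> a \<mu> g \<longleftrightarrow> a \<ge> 0 \<and> \<mu> \<in> M_plus \<alpha> \<and>
     (\<forall>z>0. g z \<ge> 0 \<and> ennreal (g z) = ennreal a + S_transform \<alpha> \<mu> z)"

definition gen_stieltjes :: "real \<Rightarrow> (real \<Rightarrow> real) set" where
  "gen_stieltjes \<alpha> = {g. \<exists>a \<mu>. stieltjes_rep \<alpha> a \<mu> g}"

text \<open>\<open>\<mu>\<close> has no singular continuous part: the continuous part of \<open>\<mu>\<close> (i.e. \<open>\<mu>\<close>
  with its atoms removed) is absolutely continuous w.r.t. Lebesgue measure; equivalently,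
  \<open>\<mu> = \<mu>_pp + \<mu>_ac\<close>.\<close>
definition no_singular_continuous_part :: "real measure \<Rightarrow> bool" where
  "no_singular_continuous_part \<mu> \<longleftrightarrow>
     (\<forall>A \<in> sets borel. emeasure lborel A = 0 \<longrightarrow>
        emeasure \<mu> (A - {x. emeasure \<mu> {x} \<noteq> 0}) = 0)"

end

theory Submission
  imports Defs "HOL-Probability.Probability" "HOL-Real_Asymp.Real_Asymp"
begin

text \<open>
  The limit condition forces \<open>\<Psi>[f](s) = \<integral> \<nu>(dt) / (s + t)\<close> with \<open>\<nu>\<close> of total mass \<open>\<gamma>\<close>.
  For \<open>\<gamma> > 0\<close> put \<open>\<rho> = \<gamma> \<alpha>\<close>, \<open>p = \<nu> / \<gamma>\<close> and \<open>Y(t) = 1 / (1 + t) \<in> (0,1]\<close>. Let \<open>X\<close> be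
  the mean of \<open>Y\<close> under a Dirichlet process with parameter \<open>\<rho> p\<close>; its law \<open>m\<close> is
  invariant under \<open>X \<mapsto> (1 - R) Y + R X\<close>, where \<open>R, X, Y\<close> are independent and \<open>R\<close> is
  the \<open>(1/\<rho>)\<close>-th power of a uniform variable. Integrating out \<open>R\<close> by Feynman's formula
  gives \<open>E w(X)^(-\<rho>-1) = E w(X)^(-\<rho>) E (1 / w(Y))\<close> for affine \<open>w > 0\<close>. With
  \<open>w(x) = 1 + (s - 1) x\<close> this says that \<open>G(s) = E w(X)^(-\<rho>)\<close> has the same logarithmic
  derivative as \<open>f^\<alpha>\<close>, hence \<open>f^\<alpha> = C G\<close>; the substitution \<open>x = 1 / (1 + t)\<close> makes \<open>C G\<close> a
  generalized Stieltjes function whose constant comes from the atom of \<open>m\<close> at \<open>0\<close>.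

  Conditionally on \<open>X \<noteq> Y\<close> the variable \<open>(1 - R) Y + R X\<close> has an absolutely continuous law,
  so \<open>m(A) = P(X = Y \<in> A)\<close> for Lebesgue null sets \<open>A\<close>, which vanishes when \<open>A\<close> contains no
  atom of \<open>m\<close>. By uniqueness of the representation this passes to \<open>\<mu>\<close>.
\<close>

section \<open>Differentiation under the integral sign\<close>

text \<open>Dominated convergence applied to difference quotients along an arbitrary sequence
  tending to 0. It serves both the transforms of a measure on the half-line and the function
  \<open>G\<close>.\<close>

lemma has_real_derivative_integral:
  fixes g g' :: "real \<Rightarrow> 'a \<Rightarrow> real"
  assumes e: "0 < e"
    and int: "\<And>x. \<bar>x - x0\<bar> < e \<Longrightarrow> integrable M (g x)"
    and meas: "g' x0 \<in> borel_measurable M"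
    and der: "AE t in M. \<forall>x. \<bar>x - x0\<bar> < e \<longrightarrow> ((\<lambda>x. g x t) has_real_derivative g' x t) (at x)"
    and bnd: "AE t in M. \<forall>x. \<bar>x - x0\<bar> < e \<longrightarrow> \<bar>g' x t\<bar> \<le> w t"
    and w: "integrable M w"
  shows "((\<lambda>x. \<integral>t. g x t \<partial>M) has_real_derivative (\<integral>t. g' x0 t \<partial>M)) (at x0)"
  unfolding DERIV_def tendsto_at_iff_sequentially
proof (intro allI impI)
  fix X :: "nat \<Rightarrow> real"
  assume X: "\<forall>i. X i \<in> UNIV - {0}" and X0: "X \<longlonglongrightarrow> 0"
  have ev: "eventually (\<lambda>n. \<bar>X n\<bar> < e) sequentially"
    using order_tendstoD(2)[OF tendsto_rabs[OF X0]] e by simp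
  \<comment> \<open>Nothing is known about \<open>g (x0 + X n)\<close> when \<open>X n\<close>
    leaves the interval of radius \<open>e\<close>. Setting the quotient to 0 there makes every
    \<open>q n\<close> measurable and dominated by \<open>w\<close>, while eventually it is the true
    quotient.\<close>
  define q where "q n t = (if \<bar>X n\<bar> < e then (g (x0 + X n) t - g x0 t) / X n else 0)" for n t
  have int0: "integrable M (g x0)" using int[of x0] e by simp
  have intX: "\<bar>X n\<bar> < e \<Longrightarrow> integrable M (g (x0 + X n))" for n
    using int[of "x0 + X n"] by simp
  have qm: "q n \<in> borel_measurable M" for n
  proof (cases "\<bar>X n\<bar> < e")
    case True
    then have "integrable M (\<lambda>t. (g (x0 + X n) t - g x0 t) / X n)"
      using intX[OF True] int0 by simp
    then show ?thesis using True unfolding q_def by simp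
  qed (simp add: q_def[abs_def])
  have "(\<lambda>n. \<integral>t. q n t \<partial>M) \<longlonglongrightarrow> (\<integral>t. g' x0 t \<partial>M)"
  proof (rule integral_dominated_convergence[OF meas qm w])
    show "AE t in M. (\<lambda>n. q n t) \<longlonglongrightarrow> g' x0 t"
      using der
    proof eventually_elim
      case (elim t)
      then have "((\<lambda>x. g x t) has_real_derivative g' x0 t) (at x0)" using e by simp
      then have "(\<lambda>n. (g (x0 + X n) t - g x0 t) / X n) \<longlonglongrightarrow> g' x0 t"
        using X X0 unfolding DERIV_def tendsto_at_iff_sequentially comp_def by blast
      then show ?case
        by (rule Lim_transform_eventually) (use ev in \<open>auto elim!: eventually_mono simp: q_def\<close>)
    qed
    show "AE t in M. norm (q n t) \<le> w t" for n
      using der bnd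
    proof eventually_elim
      case (elim t)
      have w0: "0 \<le> w t" using order_trans[OF abs_ge_zero elim(2)[rule_format, of x0]] e by simp
      show ?case
      proof (cases "\<bar>X n\<bar> < e")
        case True
        \<comment> \<open>The mean value inequality turns the bound on the derivative into a bound
          on the quotient.\<close>
        have "norm (g (x0 + X n) t - g x0 t) \<le> w t * norm (x0 + X n - x0)"
        proof (rule field_differentiable_bound[where S = "ball x0 e" and f' = "\<lambda>x. g' x t"])
          show "((\<lambda>x. g x t) has_field_derivative g' z t) (at z within ball x0 e)" if "z \<in> ball x0 e" for z
            by (rule has_field_derivative_at_within) (use elim(1) that in \<open>simp add: dist_real_def abs_minus_commute\<close>)
          show "norm (g' z t) \<le> w t" if "z \<in> ball x0 e" for z
            using elim(2) that by (auto simp: dist_real_def abs_minus_commute)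
        qed (use True e in \<open>auto simp: dist_real_def\<close>)
        then show ?thesis using X True by (simp add: q_def field_simps)
      qed (simp add: q_def w0)
    qed
  qed
  then show "((\<lambda>h. ((\<integral>t. g (x0 + h) t \<partial>M) - (\<integral>t. g x0 t \<partial>M)) / h) \<circ> X) \<longlonglongrightarrow> (\<integral>t. g' x0 t \<partial>M)"
    unfolding comp_def
    by (rule Lim_transform_eventually)
       (use ev in \<open>auto elim!: eventually_mono simp: q_def int0 intX\<close>)
qed

section \<open>Measures on [-1,1] are determined by their moments\<close>

text \<open>Both characteristic functions have the same Taylor polynomials at 0. For a law on [-1,1]
  the remainder is at most 2 |t|^n / n!, which tends to 0.\<close>

lemma char_eq_if_moments_eq:
  assumes "real_distribution P" "real_distribution Q"
    and P1: "AE x in P. \<bar>x\<bar> \<le> 1" and Q1: "AE x in Q. \<bar>x\<bar> \<le> 1"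
    and mom: "\<And>n. (\<integral>x. x ^ n \<partial>P) = (\<integral>x. x ^ n \<partial>Q)"
  shows "char P = char Q"
proof
  fix t
  have *: "cmod (char M t - (\<Sum>k\<le>n. ((\<i> * t)^k / fact k) * (\<integral>x. x ^ k \<partial>M))) \<le> 2 * \<bar>t\<bar>^n / fact n"
    if M: "real_distribution M" and M1: "AE x in M. \<bar>x\<bar> \<le> 1" for M n
  proof -
    interpret real_distribution M by fact
    have i: "integrable M (\<lambda>x. x ^ k)" for k
      by (rule integrable_const_bound[where B=1])
         (use M1 in \<open>auto elim!: eventually_mono simp: power_abs power_le_one\<close>)
    have "expectation (\<lambda>x. \<bar>x\<bar>^n) \<le> expectation (\<lambda>x. 1)"
      by (rule integral_mono_AE)
         (use integrable_abs[OF i[of n]] M1 in \<open>auto elim!: eventually_mono simp: power_abs power_le_one\<close>)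
    then have "(2*\<bar>t\<bar>^n / fact n) * expectation (\<lambda>x. \<bar>x\<bar>^n) \<le> (2*\<bar>t\<bar>^n / fact n) * 1"
      by (intro mult_left_mono) (use prob_space in auto)
    then show ?thesis by (intro order_trans[OF char_approx1[OF i]]) simp
  qed
  have "cmod (char P t - char Q t) \<le> 4 * (\<bar>t\<bar>^n / fact n)" for n
  proof -
    let ?s = "\<Sum>k\<le>n. ((\<i> * t)^k / fact k) * (\<integral>x. x ^ k \<partial>P)"
    have "cmod ((char P t - ?s) - (char Q t - ?s)) \<le> 2 * \<bar>t\<bar>^n / fact n + 2 * \<bar>t\<bar>^n / fact n"
      using *[OF assms(1) P1, of n] *[OF assms(2) Q1, of n] mom
      by (intro order_trans[OF norm_triangle_ineq4 add_mono]) auto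
    then show ?thesis by simp
  qed
  moreover have "(\<lambda>n. 4 * (\<bar>t\<bar>^n / fact n)) \<longlonglongrightarrow> 4 * 0"
    using summable_LIMSEQ_zero[OF summable_exp[of "\<bar>t\<bar>"]]
    by (intro tendsto_mult tendsto_const) (simp add: field_simps)
  ultimately have "cmod (char P t - char Q t) \<le> 0"
    by (intro LIMSEQ_le_const) auto
  then show "char P t = char Q t" by simp
qed

text \<open>The zeroth moments give a common total mass \<open>c\<close>. If \<open>c\<close> is
  positive, dividing by it reduces the claim to probability laws and Levy's uniqueness theorem;
  multiplying by \<open>c\<close> undoes this.\<close>

lemma finite_measure_eqI_moments:
  fixes P Q :: "real measure"
  assumes "finite_measure P" "finite_measure Q" and sP[measurable_cong]: "sets P = sets borel" and sQ[measurable_cong]: "sets Q = sets borel"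
    and P1: "AE x in P. \<bar>x\<bar> \<le> 1" and Q1: "AE x in Q. \<bar>x\<bar> \<le> 1"
    and mom: "\<And>n. (\<integral>x. x ^ n \<partial>P) = (\<integral>x. x ^ n \<partial>Q)"
  shows "P = Q"
proof -
  interpret P: finite_measure P by fact
  interpret Q: finite_measure Q by fact
  define c where "c = measure P (space P)"
  have c: "emeasure P (space P) = c" "emeasure Q (space Q) = c"
    using mom[of 0] by (simp_all add: c_def P.emeasure_eq_measure Q.emeasure_eq_measure)
  show ?thesis
  proof (cases "c = 0")
    case True
    then have "emeasure P A = 0" "emeasure Q A = 0" for A
      using c by (auto intro: order.antisym simp: emeasure_space order_trans)
         (metis emeasure_space ennreal_0 le_zero_eq)+
    then show ?thesis by (intro measure_eqI) (auto simp: sP sQ)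
  next
    case False
    then have c0: "c > 0" by (simp add: c_def zero_less_measure_iff)
    let ?n = "\<lambda>M. density M (\<lambda>_. ennreal (1 / c))"
    have rd: "real_distribution (?n M)" if "sets M = sets borel" "emeasure M (space M) = c" for M
    proof -
      have "emeasure (?n M) (space M) = 1"
        using that c0 by (subst emeasure_density) (auto simp: nn_integral_cmult ennreal_mult[symmetric])
      then show ?thesis using that 
        by (auto simp: real_distribution_def real_distribution_axioms_def intro!: prob_spaceI)
    qed
    have "?n P = ?n Q"
    proof (rule Levy_uniqueness[OF rd rd char_eq_if_moments_eq[OF rd rd]])
      show "AE x in ?n P. \<bar>x\<bar> \<le> 1" "AE x in ?n Q. \<bar>x\<bar> \<le> 1"
        using P1 Q1 by (auto simp: AE_density)
      show "(\<integral>x. x ^ n \<partial>?n P) = (\<integral>x. x ^ n \<partial>?n Q)" for n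
        using mom[of n] c0 by (simp add: integral_density)
    qed (use c sP sQ in auto)
    then have "density (?n P) (\<lambda>_. ennreal c) = density (?n Q) (\<lambda>_. ennreal c)" by simp
    then show ?thesis using c0
      by (simp add: density_density_eq ennreal_mult[symmetric] density_1)
  qed
qed

section \<open>Uniqueness of the Stieltjes representation\<close>

lemma M_plusD:
  assumes "\<mu> \<in> M_plus \<rho>"
  shows M_plus_sets: "sets \<mu> = sets borel"
    and M_plus_AE_nonneg: "AE t in \<mu>. 0 \<le> t"
proof -
  show s: "sets \<mu> = sets borel" using assms by (simp add: M_plus_def)
  have "{..<0} \<in> null_sets \<mu>"
    using assms s by (auto simp: M_plus_def null_sets_def)
  then show "AE t in \<mu>. 0 \<le> t"
    by (rule AE_I') auto
qed

lemma M_plus_measurable: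
  assumes "\<mu> \<in> M_plus \<rho>" "f \<in> borel_measurable borel"
  shows "f \<in> borel_measurable \<mu>"
  using assms measurable_cong_sets[OF M_plus_sets[OF assms(1)] refl] by blast

text \<open>Comparison with the kernel that defines \<open>M_plus\<close>: s + t is at least
  min(s,1) (1 + t), and since 1 + t is at least 1, a larger exponent only helps.\<close>

lemma integrable_S_kernel:
  assumes \<mu>: "\<mu> \<in> M_plus \<rho>" and "\<rho> \<le> \<beta>" "0 \<le> \<rho>" and s: "s > 0"
  shows "integrable \<mu> (\<lambda>t. (s + t) powr - \<beta>)"
proof (rule Bochner_Integration.integrable_bound)
  note [measurable_cong] = M_plus_sets[OF \<mu>]
  let ?c = "min s 1"
  show "integrable \<mu> (\<lambda>t. ?c powr - \<beta> * (1 + t) powr - \<rho>)"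
    using \<mu> by (auto intro!: integrableI_nonneg integrable_mult_right simp: M_plus_def)
  show "AE t in \<mu>. norm ((s + t) powr - \<beta>) \<le> norm (?c powr - \<beta> * (1 + t) powr - \<rho>)"
    using M_plus_AE_nonneg[OF \<mu>]
  proof eventually_elim
    case (elim t)
    have "?c * (1 + t) \<le> s + t"
      using elim s by (auto simp: min_def algebra_simps mult_left_le_one_le)
    then have "(s + t) powr - \<beta> \<le> (?c * (1 + t)) powr - \<beta>"
      using assms elim by (intro powr_mono2') auto
    also have "\<dots> = ?c powr - \<beta> * (1 + t) powr - \<beta>"
      using s elim by (simp add: powr_mult)
    also have "\<dots> \<le> ?c powr - \<beta> * (1 + t) powr - \<rho>"
      using assms elim by (intro mult_left_mono powr_mono) auto
    finally show ?case by simp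
  qed
qed (rule M_plus_measurable[OF \<mu>], measurable)

lemma has_real_derivative_S_transform:
  assumes \<mu>: "\<mu> \<in> M_plus \<rho>" and le: "\<rho> \<le> \<beta>" "0 \<le> \<rho>" and s: "s > 0"
  shows "((\<lambda>s. \<integral>t. (s + t) powr - \<beta> \<partial>\<mu>) has_real_derivative
    - \<beta> * (\<integral>t. (s + t) powr - (\<beta> + 1) \<partial>\<mu>)) (at s)"
proof -
  note [measurable_cong] = M_plus_sets[OF \<mu>]
  have "((\<lambda>s. \<integral>t. (s + t) powr - \<beta> \<partial>\<mu>) has_real_derivative
      (\<integral>t. - \<beta> * (s + t) powr - (\<beta> + 1) \<partial>\<mu>)) (at s)"
  \<comment> \<open>Points within s/2 of s stay above s/2, so the kernel at s/2 dominates.\<close>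
  proof (rule has_real_derivative_integral[where e = "s / 2" and w = "\<lambda>t. \<beta> * (s / 2 + t) powr - (\<beta> + 1)"])
    show "integrable \<mu> (\<lambda>t. (x + t) powr - \<beta>)" if "\<bar>x - s\<bar> < s / 2" for x
      using that s by (intro integrable_S_kernel[OF \<mu> le]) (auto simp: abs_if field_simps split: if_splits)
    show "integrable \<mu> (\<lambda>t. \<beta> * (s / 2 + t) powr - (\<beta> + 1))"
      using s le by (intro integrable_mult_right integrable_S_kernel[OF \<mu>]) auto
    show "AE t in \<mu>. \<forall>x. \<bar>x - s\<bar> < s / 2 \<longrightarrow>
        ((\<lambda>x. (x + t) powr - \<beta>) has_real_derivative - \<beta> * (x + t) powr - (\<beta> + 1)) (at x)"
      using M_plus_AE_nonneg[OF \<mu>]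
    proof eventually_elim
      case (elim t)
      have "((\<lambda>x. (x + t) powr - \<beta>) has_real_derivative - \<beta> * (x + t) powr - (\<beta> + 1)) (at x)"
        if "0 < x" for x
        using that elim unfolding minus_add_distrib by (auto intro!: derivative_eq_intros)
      moreover have "0 < x" if "\<bar>x - s\<bar> < s / 2" for x using that s by (auto simp: abs_if field_simps split: if_splits)
      ultimately show ?case by blast
    qed
    show "AE t in \<mu>. \<forall>x. \<bar>x - s\<bar> < s / 2 \<longrightarrow>
        \<bar>- \<beta> * (x + t) powr - (\<beta> + 1)\<bar> \<le> \<beta> * (s / 2 + t) powr - (\<beta> + 1)"
      using M_plus_AE_nonneg[OF \<mu>]
    proof eventually_elim
      case (elim t)
      have "(x + t) powr - (\<beta> + 1) \<le> (s / 2 + t) powr - (\<beta> + 1)" if "\<bar>x - s\<bar> < s / 2" for x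
        using that s elim le by (intro powr_mono2') (auto simp: abs_if field_simps split: if_splits)
      then show ?case using le by (auto simp: abs_mult intro!: mult_left_mono)
    qed
  qed (use s in \<open>auto intro!: M_plus_measurable[OF \<mu>]\<close>)
  then show ?thesis by simp
qed

lemma stieltjes_rep_eq_integral:
  assumes "stieltjes_rep \<rho> a \<mu> g" "0 \<le> \<rho>" "s > 0"
  shows "g s = a + (\<integral>t. (s + t) powr - \<rho> \<partial>\<mu>)"
proof -
  have \<mu>: "\<mu> \<in> M_plus \<rho>" and a: "a \<ge> 0" and g: "g s \<ge> 0" "ennreal (g s) = ennreal a + S_transform \<rho> \<mu> s"
    using assms by (auto simp: stieltjes_rep_def)
  have "S_transform \<rho> \<mu> s = ennreal (\<integral>t. (s + t) powr - \<rho> \<partial>\<mu>)"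
    unfolding S_transform_def by (rule nn_integral_eq_integral[OF integrable_S_kernel[OF \<mu>]]) (use assms in auto)
  with g a show ?thesis by (simp add: ennreal_plus[symmetric] del: ennreal_plus)
qed

text \<open>Repeated differentiation of the two representations. The first derivative removes the
  constants \<open>a\<close> and \<open>b\<close>, which is why the exponents start at
  \<open>\<rho> + 1\<close>; afterwards each derivative raises the exponent by one up to a nonzero
  factor.\<close>

lemma stieltjes_rep_higher_transforms_eq:
  assumes \<mu>: "stieltjes_rep \<rho> a \<mu> g" and \<nu>: "stieltjes_rep \<rho> b \<nu> g" and \<rho>: "\<rho> > 0" and s: "s > 0"
  shows "(\<integral>t. (s + t) powr - (\<rho> + 1 + real n) \<partial>\<mu>) = (\<integral>t. (s + t) powr - (\<rho> + 1 + real n) \<partial>\<nu>)"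
  using s
proof (induction n arbitrary: s)
  have M: "\<mu> \<in> M_plus \<rho>" "\<nu> \<in> M_plus \<rho>" using \<mu> \<nu> by (auto simp: stieltjes_rep_def)
  {
    case 0
    have *: "(g has_real_derivative - \<rho> * (\<integral>t. (s + t) powr - (\<rho> + 1) \<partial>\<mu>)) (at s)"
      if "stieltjes_rep \<rho> a \<mu> g" for a \<mu>
    proof (rule DERIV_cong_ev[THEN iffD2, OF refl _ refl])
      show "\<forall>\<^sub>F x in nhds s. g x = a + (\<integral>t. (x + t) powr - \<rho> \<partial>\<mu>)"
        using eventually_nhds_in_open[of "{0<..}" s] 0
        by (auto elim!: eventually_mono intro: stieltjes_rep_eq_integral[OF that] simp: \<rho> less_imp_le)
      show "((\<lambda>x. a + (\<integral>t. (x + t) powr - \<rho> \<partial>\<mu>)) has_real_derivative - \<rho> * (\<integral>t. (s + t) powr - (\<rho> + 1) \<partial>\<mu>)) (at s)"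
        using DERIV_add[OF DERIV_const has_real_derivative_S_transform[of \<mu> \<rho> \<rho> s]] that \<rho> 0
        by (simp add: stieltjes_rep_def)
    qed
    show ?case using DERIV_unique[OF *[OF \<mu>] *[OF \<nu>]] \<rho> by simp
  next
    case (Suc n)
    let ?\<beta> = "\<rho> + 1 + real n"
    have d: "((\<lambda>s. \<integral>t. (s + t) powr - ?\<beta> \<partial>\<kappa>) has_real_derivative
        - ?\<beta> * (\<integral>t. (s + t) powr - (?\<beta> + 1) \<partial>\<kappa>)) (at s)" if "\<kappa> \<in> M_plus \<rho>" for \<kappa>
      by (rule has_real_derivative_S_transform[OF that]) (use \<rho> Suc.prems in auto)
    have "((\<lambda>s. \<integral>t. (s + t) powr - ?\<beta> \<partial>\<mu>) has_real_derivative
        - ?\<beta> * (\<integral>t. (s + t) powr - (?\<beta> + 1) \<partial>\<nu>)) (at s)"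
    proof (rule DERIV_cong_ev[THEN iffD2, OF refl _ refl d[OF M(2)]])
      show "\<forall>\<^sub>F x in nhds s. (\<integral>t. (x + t) powr - ?\<beta> \<partial>\<mu>) = (\<integral>t. (x + t) powr - ?\<beta> \<partial>\<nu>)"
        by (rule eventually_mono[OF eventually_nhds_in_open[of "{0<..}" s]]) (use Suc.prems Suc.IH in simp_all)
    qed
    from DERIV_unique[OF this d[OF M(1)]] \<rho>
    have "(\<integral>t. (s + t) powr - (?\<beta> + 1) \<partial>\<mu>) = (\<integral>t. (s + t) powr - (?\<beta> + 1) \<partial>\<nu>)"
      by (subst (asm) mult_left_cancel) auto
    then show ?case by (simp add: algebra_simps)
  }
qed

text \<open>The weight (1 + t)^(-\<rho>-1) makes the measure finite, and the substitution x = 1/(1 +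
  t) moves it to [0,1]. Its moments are then the higher transforms at s = 1, so moment determinacy
  applies and both operations are reversed.\<close>

theorem stieltjes_rep_unique:
  assumes \<mu>: "stieltjes_rep \<rho> a \<mu> g" and \<nu>: "stieltjes_rep \<rho> b \<nu> g" and \<rho>: "\<rho> > 0"
  shows "\<mu> = \<nu>"
proof -
  define D where "D \<kappa> = density \<kappa> (\<lambda>t::real. ennreal ((1 + t) powr - (\<rho> + 1)))" for \<kappa>
  define P where "P \<kappa> = distr (D \<kappa>) borel (\<lambda>t. 1 / (1 + t))" for \<kappa>
  have P: "finite_measure (P \<kappa>)" "AE x in P \<kappa>. \<bar>x\<bar> \<le> 1"
      "(\<integral>x. x ^ n \<partial>P \<kappa>) = (\<integral>t. (1 + t) powr - (\<rho> + 1 + real n) \<partial>\<kappa>)" if \<kappa>: "\<kappa> \<in> M_plus \<rho>" for \<kappa> n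
  proof -
    note [measurable_cong] = M_plus_sets[OF \<kappa>]
    have i: "integrable \<kappa> (\<lambda>t. (1 + t) powr - (\<rho> + 1))"
      by (rule integrable_S_kernel[OF \<kappa>]) (use \<rho> in auto)
    show "finite_measure (P \<kappa>)"
      unfolding P_def D_def using integrableD(2)[OF i]
      by (intro finite_measureI) (simp add: emeasure_distr emeasure_density space_density sets_eq_imp_space_eq[OF M_plus_sets[OF \<kappa>]] less_top)
    show "AE x in P \<kappa>. \<bar>x\<bar> \<le> 1"
      unfolding P_def D_def using M_plus_AE_nonneg[OF \<kappa>]
      by (subst AE_distr_iff) (auto simp: AE_density elim!: eventually_mono)
    have "(\<integral>x. x ^ n \<partial>P \<kappa>) = (\<integral>t. (1 + t) powr - (\<rho> + 1) * (1 / (1 + t)) ^ n \<partial>\<kappa>)"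
      unfolding P_def D_def by (simp add: integral_distr integral_density)
    also have "\<dots> = (\<integral>t. (1 + t) powr - (\<rho> + 1 + real n) \<partial>\<kappa>)"
      using M_plus_AE_nonneg[OF \<kappa>]
      by (intro integral_cong_AE) (auto elim!: eventually_mono simp: powr_diff powr_realpow powr_minus divide_simps powr_add)
    finally show "(\<integral>x. x ^ n \<partial>P \<kappa>) = (\<integral>t. (1 + t) powr - (\<rho> + 1 + real n) \<partial>\<kappa>)" .
  qed
  have M: "\<mu> \<in> M_plus \<rho>" "\<nu> \<in> M_plus \<rho>" using \<mu> \<nu> by (auto simp: stieltjes_rep_def)
  have "P \<mu> = P \<nu>"
    by (rule finite_measure_eqI_moments)
       (use P[OF M(1)] P[OF M(2)] stieltjes_rep_higher_transforms_eq[OF \<mu> \<nu> \<rho>, of 1] in \<open>auto simp: P_def\<close>)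
  moreover have "density (distr (P \<kappa>) borel (\<lambda>x. 1 / x - 1)) (\<lambda>t. ennreal ((1 + t) powr (\<rho> + 1))) = \<kappa>" if \<kappa>: "\<kappa> \<in> M_plus \<rho>" for \<kappa>
  proof -
    note [measurable_cong] = M_plus_sets[OF \<kappa>]
    \<comment> \<open>The two substitutions are inverse on the whole line, even at t = -1, because
      1/0 = 0.\<close>
    have "distr (P \<kappa>) borel (\<lambda>x. 1 / x - 1) = distr (D \<kappa>) borel (\<lambda>t. t)"
      unfolding P_def by (subst distr_distr) (auto simp: comp_def D_def intro!: distr_cong)
    also have "\<dots> = D \<kappa>"
      by (rule distr_id2) (simp add: D_def M_plus_sets[OF \<kappa>])
    also have "density (D \<kappa>) (\<lambda>t. ennreal ((1 + t) powr (\<rho> + 1))) = density \<kappa> (\<lambda>_. 1)"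
      unfolding D_def using M_plus_AE_nonneg[OF \<kappa>]
      by (subst density_density_eq, measurable, intro density_cong)
         (auto elim!: eventually_mono simp: ennreal_mult[symmetric] powr_add[symmetric])
    finally show ?thesis by (simp add: density_1)
  qed
  ultimately show ?thesis using M by metis
qed

section \<open>Dirichlet means by stick breaking\<close>

abbreviation unif :: "real measure" where
  "unif \<equiv> uniform_measure lborel {0..1}"

lemma prob_space_unif: "prob_space unif"
  by (rule prob_space_uniform_measure) auto

text \<open>Writing \<open>D(r)\<close> for the base of the power, \<open>r D(r)^(-\<rho>) / y\<close> is an antiderivative.\<close>

lemma feynman_parametrization:
  fixes x y \<rho> :: real
  assumes x: "x > 0" and y: "y > 0" and \<rho>: "\<rho> > 0"
  shows "(\<integral>\<^sup>+ r. ennreal (((1 - r powr (1 / \<rho>)) * y + r powr (1 / \<rho>) * x) powr - (\<rho> + 1)) \<partial>unif)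
    = ennreal (x powr - \<rho> / y)"
proof -
  define D where "D r = (1 - r powr (1 / \<rho>)) * y + r powr (1 / \<rho>) * x" for r
  have c: "0 \<le> r powr (1 / \<rho>)" "r powr (1 / \<rho>) \<le> 1" if "r \<in> {0..1}" for r
    using that \<rho> by (auto intro: powr_le1)
  have D: "D r > 0" if "r \<in> {0..1}" for r
  proof -
    have "D r \<ge> (1 - r powr (1 / \<rho>)) * min x y + r powr (1 / \<rho>) * min x y"
      unfolding D_def using c[OF that] by (intro add_mono mult_left_mono) auto
    moreover have "(1 - r powr (1 / \<rho>)) * min x y + r powr (1 / \<rho>) * min x y = min x y"
      by (simp add: algebra_simps)
    ultimately show ?thesis using x y by linarith
  qed
  have "((\<lambda>r. D r powr - (\<rho> + 1)) has_integral (1 * D 1 powr - \<rho> / y - 0 * D 0 powr - \<rho> / y)) {0..1}"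
  \<comment> \<open>The product rule is used only for 0 < r < 1, since
    \<open>r powr (1 / \<rho>)\<close> need not be differentiable at 0; continuity suffices at the
    endpoints.\<close>
  proof (rule fundamental_theorem_of_calculus_interior)
    have "continuous_on {0..1} D" unfolding D_def
      using \<rho> by (intro continuous_intros continuous_on_powr') auto
    then show "continuous_on {0..1} (\<lambda>r. r * D r powr - \<rho> / y)"
      using D y by (intro continuous_intros) (auto simp: less_le)
    fix r :: real assume r: "r \<in> {0<..<1}"
    have Dr: "D r > 0" using D r by auto
    have dc: "((\<lambda>r. r powr (1 / \<rho>)) has_real_derivative r powr (1 / \<rho>) / (\<rho> * r)) (at r)"
      using r by (auto intro!: derivative_eq_intros simp: powr_diff)
    have "((\<lambda>r. y + r powr (1 / \<rho>) * (x - y)) has_real_derivative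
        0 + r powr (1 / \<rho>) / (\<rho> * r) * (x - y)) (at r)"
      by (intro DERIV_add DERIV_const DERIV_cmult_right dc)
    moreover have "D = (\<lambda>r. y + r powr (1 / \<rho>) * (x - y))"
      by (simp add: D_def fun_eq_iff algebra_simps)
    ultimately have dD: "(D has_real_derivative r powr (1 / \<rho>) / (\<rho> * r) * (x - y)) (at r)"
      by simp
    have "((\<lambda>r. r * D r powr - \<rho> / y) has_real_derivative
        (1 * D r powr - \<rho> + (- \<rho> * D r powr (- \<rho> - 1) * (r powr (1 / \<rho>) / (\<rho> * r) * (x - y))) * r) / y) (at r)"
      by (intro DERIV_cdivide DERIV_mult DERIV_ident DERIV_chain2[OF has_real_derivative_powr[OF Dr] dD])
    also have "(1 * D r powr - \<rho> + (- \<rho> * D r powr (- \<rho> - 1) * (r powr (1 / \<rho>) / (\<rho> * r) * (x - y))) * r) / y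
       = (D r powr - \<rho> - D r powr (- \<rho> - 1) * (r powr (1 / \<rho>) * (x - y))) / y"
      using r \<rho> by simp
    also have "D r powr - \<rho> = D r powr (- \<rho> - 1) * D r"
      using Dr by (simp add: powr_diff)
    also have "(D r powr (- \<rho> - 1) * D r - D r powr (- \<rho> - 1) * (r powr (1 / \<rho>) * (x - y))) / y
        = D r powr (- \<rho> - 1) * (D r - r powr (1 / \<rho>) * (x - y)) / y"
      by (simp add: algebra_simps)
    also have "D r - r powr (1 / \<rho>) * (x - y) = y" by (simp add: D_def algebra_simps)
    finally show "((\<lambda>r. r * D r powr - \<rho> / y) has_vector_derivative D r powr - (\<rho> + 1)) (at r)"
      using y by (simp add: has_real_derivative_iff_has_vector_derivative)
  qed simp
  then have "((\<lambda>r. D r powr - (\<rho> + 1)) has_integral x powr - \<rho> / y) {0..1}" by (simp add: D_def)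
  from nn_integral_has_integral_lebesgue'[OF _ this]
  have "(\<integral>\<^sup>+ r. ennreal (D r powr - (\<rho> + 1)) * indicator {0..1} r \<partial>lborel) = ennreal (x powr - \<rho> / y)"
    by simp
  then show ?thesis
    unfolding D_def by (subst nn_integral_uniform_measure) (auto simp: divide_ennreal_def)
qed

text \<open>A point v of the segment other than y determines r as ((v - y)/(x - y))^\<rho>. This map
  is differentiable where the base is positive, so it sends null sets to null sets. The remaining
  value r = 0 is a single point.\<close>

lemma AE_unif_segment_notin_null_set:
  fixes x y \<rho> :: real
  assumes A: "A \<in> null_sets lborel" and xy: "x \<noteq> y" and \<rho>: "\<rho> > 0"
  shows "AE r in unif. (1 - r powr (1 / \<rho>)) * y + r powr (1 / \<rho>) * x \<notin> A"
proof -
  let ?d = "\<lambda>r. (1 - r powr (1 / \<rho>)) * y + r powr (1 / \<rho>) * x"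
  let ?g = "\<lambda>v. ((v - y) / (x - y)) powr \<rho>"
  let ?S = "{v \<in> A. (v - y) / (x - y) > 0}"
  have [measurable]: "A \<in> sets borel" using A by auto
  have "negligible A"
    using A by (simp add: negligible_iff_null_sets null_sets_completionI)
  then have "negligible ?S" by (rule negligible_subset) auto
  moreover have "?g differentiable_on ?S"
  proof (unfold differentiable_on_def, intro ballI)
    fix v assume "v \<in> ?S"
    then have "(?g has_real_derivative \<rho> * ((v - y) / (x - y)) powr (\<rho> - 1) * (1 / (x - y))) (at v)"
      using xy by (auto intro!: derivative_eq_intros)
    then have "?g differentiable (at v)" unfolding real_differentiable_def by (rule exI)
    then show "?g differentiable (at v within ?S)" by (rule differentiable_at_withinI)
  qed
  ultimately have "negligible (?g ` ?S)"
    by (intro negligible_differentiable_image_negligible) auto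
  moreover have "{r \<in> {0<..1}. ?d r \<in> A} \<subseteq> ?g ` ?S"
  proof
    fix r assume r: "r \<in> {r \<in> {0<..1}. ?d r \<in> A}"
    then have q: "(?d r - y) / (x - y) = r powr (1 / \<rho>)"
      using xy by (simp add: field_simps)
    then have "?g (?d r) = r" using r \<rho> by (simp add: powr_powr)
    moreover have "?d r \<in> ?S" using r q by simp
    ultimately show "r \<in> ?g ` ?S" by (metis (no_types, lifting) image_eqI)
  qed
  ultimately have "negligible {r \<in> {0<..1}. ?d r \<in> A}"
    using negligible_subset by blast
  moreover have "{r \<in> {0<..1}. ?d r \<in> A} \<in> sets lborel" by measurable
  ultimately have "{r \<in> {0<..1}. ?d r \<in> A} \<in> null_sets lborel"
    by (simp add: negligible_iff_null_sets null_sets_def)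
  then have "AE r in lborel. \<not> (r \<in> {0<..1} \<and> ?d r \<in> A)"
    by (rule AE_I') auto
  moreover have "AE r in lborel. r \<noteq> (0::real)" by (rule AE_lborel_singleton)
  ultimately show ?thesis
    by (intro AE_uniform_measureI) (auto elim!: AE_mp)
qed

text \<open>The law of \<open>\<Sum>n. c\<^sub>0 \<dots> c\<^sub>n\<^sub>-\<^sub>1 (1 - c\<^sub>n) Y\<^sub>n\<close> for independent copies \<open>(c\<^sub>n, Y\<^sub>n)\<close>.\<close>

lemma stick_breaking_fixed_point:
  assumes "prob_space M" and [measurable]: "c \<in> borel_measurable M" "Y \<in> borel_measurable M"
    and c: "\<And>\<omega>. \<omega> \<in> space M \<Longrightarrow> c \<omega> \<in> {0..1::real}"
    and Y: "\<And>\<omega>. \<omega> \<in> space M \<Longrightarrow> Y \<omega> \<in> {0..1::real}"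
  obtains m where "prob_space m" "sets m = sets borel" "AE x in m. x \<in> {0..1}"
    "\<And>g. g \<in> borel_measurable borel \<Longrightarrow>
      (\<integral>\<^sup>+ x. g x \<partial>m) = (\<integral>\<^sup>+ \<omega>. \<integral>\<^sup>+ x. g ((1 - c \<omega>) * Y \<omega> + c \<omega> * x) \<partial>m \<partial>M)"
proof -
  interpret prob_space M by fact
  let ?S = "stream_space M"
  interpret S: prob_space ?S by (rule prob_space_stream_space)
  define a where "a \<sigma> n = (\<Prod>k<n. c (\<sigma> !! k)) * ((1 - c (\<sigma> !! n)) * Y (\<sigma> !! n))" for \<sigma> n
  define V where "V \<sigma> = (\<Sum>n. a \<sigma> n)" for \<sigma>
  have snth: "\<sigma> !! n \<in> space M" if "\<sigma> \<in> space ?S" for \<sigma> n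
    using that by (auto simp: space_stream_space streams_iff_snth)
  have a0: "0 \<le> a \<sigma> n" if "\<sigma> \<in> space ?S" for \<sigma> n
    unfolding a_def using c[OF snth[OF that]] Y[OF snth[OF that]]
    by (auto intro!: mult_nonneg_nonneg prod_nonneg)
  \<comment> \<open>The right-hand side is the part of the stick broken off so far. The bound gives
    summability even if the remaining length does not tend to 0.\<close>
  have le: "(\<Sum>k<n. a \<sigma> k) \<le> 1 - (\<Prod>k<n. c (\<sigma> !! k))" if \<sigma>: "\<sigma> \<in> space ?S" for \<sigma> n
  proof (induction n)
    case (Suc n)
    have "a \<sigma> n \<le> (\<Prod>k<n. c (\<sigma> !! k)) * (1 - c (\<sigma> !! n))"
      unfolding a_def using c[OF snth[OF \<sigma>]] Y[OF snth[OF \<sigma>]]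
      by (intro mult_left_mono mult_left_le prod_nonneg) auto
    with Suc show ?case by (simp add: algebra_simps)
  qed simp
  have le1: "(\<Sum>k<n. a \<sigma> k) \<le> 1" if \<sigma>: "\<sigma> \<in> space ?S" for \<sigma> n
  proof -
    have "0 \<le> (\<Prod>k<n. c (\<sigma> !! k))" using c[OF snth[OF \<sigma>]] by (intro prod_nonneg) auto
    with le[OF \<sigma>, of n] show ?thesis by linarith
  qed
  have sm: "summable (a \<sigma>)" if "\<sigma> \<in> space ?S" for \<sigma>
    by (rule summableI_nonneg_bounded[OF a0[OF that] le1[OF that]])
  have V01: "V \<sigma> \<in> {0..1}" if "\<sigma> \<in> space ?S" for \<sigma>
    unfolding V_def using sm[OF that] a0[OF that] le1[OF that]
    by (auto intro: suminf_nonneg suminf_le_const)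
  \<comment> \<open>Every later term contains the first factor \<open>c \<omega>\<close>. This is
    the fixed point equation path by path; the stream measure supplies the independence of head and
    tail.\<close>
  have V_Stream: "V (\<omega> ## \<sigma>) = (1 - c \<omega>) * Y \<omega> + c \<omega> * V \<sigma>" if "\<omega> \<in> space M" "\<sigma> \<in> space ?S" for \<omega> \<sigma>
  proof -
    have s: "\<omega> ## \<sigma> \<in> space ?S" using that by (simp add: stream_space_Stream)
    have "(\<Sum>n. a (\<omega> ## \<sigma>) (Suc n)) = (\<Sum>n. c \<omega> * a \<sigma> n)"
      by (intro suminf_cong) (simp add: a_def prod.lessThan_Suc_shift del: prod.lessThan_Suc)
    also have "\<dots> = c \<omega> * V \<sigma>" unfolding V_def by (rule suminf_mult[OF sm[OF that(2)]])
    finally have "V (\<omega> ## \<sigma>) - a (\<omega> ## \<sigma>) 0 = c \<omega> * V \<sigma>"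
      unfolding suminf_split_head[OF sm[OF s]] V_def .
    then show ?thesis by (simp add: a_def)
  qed
  have [measurable]: "V \<in> borel_measurable ?S" unfolding V_def a_def by measurable
  define m where "m = distr ?S borel V"
  show ?thesis
  proof
    show "prob_space m" unfolding m_def by (rule S.prob_space_distr) measurable
    show "sets m = sets borel" by (simp add: m_def)
    show "AE x in m. x \<in> {0..1}"
      unfolding m_def by (subst AE_distr_iff) (use V01 in auto)
    fix g :: "real \<Rightarrow> ennreal" assume g[measurable]: "g \<in> borel_measurable borel"
    have "(\<integral>\<^sup>+ x. g x \<partial>m) = (\<integral>\<^sup>+ \<sigma>. g (V \<sigma>) \<partial>?S)"
      unfolding m_def by (rule nn_integral_distr) measurable
    also have "\<dots> = (\<integral>\<^sup>+ \<omega>. \<integral>\<^sup>+ \<sigma>. g (V (\<omega> ## \<sigma>)) \<partial>?S \<partial>M)"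
      by (rule nn_integral_stream_space) measurable
    also have "\<dots> = (\<integral>\<^sup>+ \<omega>. \<integral>\<^sup>+ \<sigma>. g ((1 - c \<omega>) * Y \<omega> + c \<omega> * V \<sigma>) \<partial>?S \<partial>M)"
      by (intro nn_integral_cong) (simp add: V_Stream)
    also have "\<dots> = (\<integral>\<^sup>+ \<omega>. \<integral>\<^sup>+ x. g ((1 - c \<omega>) * Y \<omega> + c \<omega> * x) \<partial>m \<partial>M)"
      unfolding m_def by (intro nn_integral_cong, subst nn_integral_distr) auto
    finally show "(\<integral>\<^sup>+ x. g x \<partial>m) = (\<integral>\<^sup>+ \<omega>. \<integral>\<^sup>+ x. g ((1 - c \<omega>) * Y \<omega> + c \<omega> * x) \<partial>m \<partial>M)" .
  qed
qed

text \<open>\<open>m\<close> is the law of the mean of \<open>Y\<close> under a Dirichlet process with parameter measure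
  \<open>\<rho> p\<close>, characterised by its distributional fixed point equation; \<open>1 - r powr (1 / \<rho>)\<close> is
  \<open>Beta(1, \<rho>)\<close> distributed for uniform \<open>r\<close>.\<close>

locale dirichlet_mean = p: prob_space p + m: prob_space m
  for p :: "'a measure" and m :: "real measure" +
  fixes \<rho> :: real and Y :: "'a \<Rightarrow> real"
  assumes \<rho>: "\<rho> > 0" and Y_meas[measurable]: "Y \<in> borel_measurable p"
    and Y01: "\<And>t. 0 < Y t \<and> Y t \<le> 1"
    and sets_m[measurable_cong]: "sets m = sets borel"
    and m01: "AE x in m. x \<in> {0..1}"
    and fixed_point: "\<And>g. g \<in> borel_measurable borel \<Longrightarrow>
      (\<integral>\<^sup>+ x. g x \<partial>m) = (\<integral>\<^sup>+ t. \<integral>\<^sup>+ x. \<integral>\<^sup>+ r.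
        g ((1 - r powr (1 / \<rho>)) * Y t + r powr (1 / \<rho>) * x) \<partial>unif \<partial>m \<partial>p)"

lemma dirichlet_mean_exists:
  assumes "prob_space p" and Y_meas[measurable]: "Y \<in> borel_measurable p"
    and Y01: "\<And>t. 0 < Y t \<and> Y t \<le> 1" and \<rho>: "\<rho> > 0"
  obtains m where "dirichlet_mean p m \<rho> Y"
proof -
  interpret p: prob_space p by fact
  interpret u: prob_space unif by (rule prob_space_unif)
  interpret up: pair_prob_space p unif ..
  \<comment> \<open>The space of \<open>unif\<close> is the whole line, while stick breaking wants
    values in [0,1] everywhere; the clamping changes nothing on [0,1].\<close>
  define c where "c r = (min 1 (max 0 r)) powr (1 / \<rho>)" for r :: real
  have [measurable]: "c \<in> borel_measurable borel" unfolding c_def by measurable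
  have c01: "c r \<in> {0..1}" for r using \<rho> by (auto simp: c_def intro!: powr_le1)
  obtain m where m: "prob_space m" "sets m = sets borel" "AE x in m. x \<in> {0..1}"
    and fp: "\<And>g. g \<in> borel_measurable borel \<Longrightarrow>
      (\<integral>\<^sup>+ x. g x \<partial>m) = (\<integral>\<^sup>+ \<omega>. \<integral>\<^sup>+ x. g ((1 - c (snd \<omega>)) * Y (fst \<omega>) + c (snd \<omega>) * x) \<partial>m \<partial>(p \<Otimes>\<^sub>M unif))"
  proof (rule stick_breaking_fixed_point[of "p \<Otimes>\<^sub>M unif" "\<lambda>\<omega>. c (snd \<omega>)" "\<lambda>\<omega>. Y (fst \<omega>)"])
    show "prob_space (p \<Otimes>\<^sub>M unif)" by (rule up.P.prob_space_axioms)
    show "c (snd \<omega>) \<in> {0..1}" "Y (fst \<omega>) \<in> {0..1}" for \<omega> :: "'a \<times> real"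
      using c01 Y01[of "fst \<omega>"] by auto
    show "(\<lambda>\<omega>. c (snd \<omega>)) \<in> borel_measurable (p \<Otimes>\<^sub>M unif)"
      "(\<lambda>\<omega>. Y (fst \<omega>)) \<in> borel_measurable (p \<Otimes>\<^sub>M unif)" by measurable
  qed (rule that)
  interpret m: prob_space m by fact
  interpret um: pair_sigma_finite unif m ..
  note [measurable_cong] = m(2)
  show ?thesis
  proof (rule that, unfold_locales)
    fix g :: "real \<Rightarrow> ennreal" assume g[measurable]: "g \<in> borel_measurable borel"
    have "(\<integral>\<^sup>+ x. g x \<partial>m) = (\<integral>\<^sup>+ t. \<integral>\<^sup>+ r. \<integral>\<^sup>+ x. g ((1 - c r) * Y t + c r * x) \<partial>m \<partial>unif \<partial>p)"
      unfolding fp[OF g] by (subst u.nn_integral_fst[symmetric]) auto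
    also have "\<dots> = (\<integral>\<^sup>+ t. \<integral>\<^sup>+ x. \<integral>\<^sup>+ r. g ((1 - c r) * Y t + c r * x) \<partial>unif \<partial>m \<partial>p)"
      by (intro nn_integral_cong um.Fubini'[symmetric]) measurable
    also have "\<dots> = (\<integral>\<^sup>+ t. \<integral>\<^sup>+ x. \<integral>\<^sup>+ r. g ((1 - r powr (1 / \<rho>)) * Y t + r powr (1 / \<rho>) * x) \<partial>unif \<partial>m \<partial>p)"
      by (intro nn_integral_cong nn_integral_cong_AE AE_uniform_measureI) (auto simp: c_def min_def max_def)
    finally show "(\<integral>\<^sup>+ x. g x \<partial>m) = (\<integral>\<^sup>+ t. \<integral>\<^sup>+ x. \<integral>\<^sup>+ r.
        g ((1 - r powr (1 / \<rho>)) * Y t + r powr (1 / \<rho>) * x) \<partial>unif \<partial>m \<partial>p)" .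
  qed (use \<rho> Y01 m in auto)
qed

section \<open>The Markov-Krein identity\<close>

text \<open>The affine function is the convex combination of 1 and s with weight x on s.\<close>

lemma affine_lower_bound:
  fixes s x :: real
  assumes "x \<in> {0..1}"
  shows "min s 1 \<le> 1 + (s - 1) * x"
proof -
  have "(1 - x) * min s 1 + x * min s 1 \<le> (1 - x) * 1 + x * s"
    using assms by (intro add_mono mult_left_mono) auto
  then show ?thesis by (simp add: algebra_simps)
qed

lemma affine_pos:
  fixes s x :: real
  assumes "s > 0" "x \<in> {0..1}"
  shows "0 < 1 + (s - 1) * x"
  using affine_lower_bound[OF assms(2), of s] assms(1) by simp

lemma powr_affine_bound:
  fixes s x b :: real
  assumes s: "s > 0" and b: "b \<ge> 0" and x: "x \<in> {0..1}"
  shows "(1 + (s - 1) * x) powr - b \<le> min s 1 powr - b"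
  using affine_lower_bound[OF x, of s] s b by (intro powr_mono2') auto

context dirichlet_mean
begin

text \<open>In the fixed point equation for the indicator of A the integral over r vanishes whenever
  x differs from \<open>Y t\<close>. Only the pairs with x = \<open>Y t\<close> in A remain, and for
  fixed t they have mass \<open>m {Y t}\<close> = 0.\<close>

lemma null_set_if_no_atoms:
  assumes A: "A \<in> null_sets lborel" and atoms: "\<And>x. x \<in> A \<Longrightarrow> emeasure m {x} = 0"
  shows "emeasure m A = 0"
proof -
  have [measurable]: "A \<in> sets borel" using A by auto
  have *: "(\<integral>\<^sup>+ r. indicator A ((1 - r powr (1 / \<rho>)) * y + r powr (1 / \<rho>) * x) \<partial>unif)
      \<le> (indicator ({y} \<inter> A) x :: ennreal)" for x y
  proof (cases "x = y")
    case True
    interpret u: prob_space unif by (rule prob_space_unif)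
    have "(1 - r powr (1 / \<rho>)) * y + r powr (1 / \<rho>) * y = y" for r
      by (simp add: algebra_simps)
    with True show ?thesis by (simp add: u.emeasure_space_1[simplified] split: split_indicator)
  next
    case False
    have "(\<integral>\<^sup>+ r. indicator A ((1 - r powr (1 / \<rho>)) * y + r powr (1 / \<rho>) * x) \<partial>unif) = (\<integral>\<^sup>+ r. 0 \<partial>unif)"
      using AE_unif_segment_notin_null_set[OF A False \<rho>]
      by (intro nn_integral_cong_AE) (auto elim!: eventually_mono)
    then show ?thesis by simp
  qed
  have "emeasure m A = (\<integral>\<^sup>+ x. indicator A x \<partial>m)"
    by (simp add: sets_m)
  also have "\<dots> \<le> (\<integral>\<^sup>+ t. \<integral>\<^sup>+ x. indicator ({Y t} \<inter> A) x \<partial>m \<partial>p)"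
    by (subst fixed_point, simp) (intro nn_integral_mono *)
  also have "\<dots> = (\<integral>\<^sup>+ t. 0 \<partial>p)"
  proof (intro nn_integral_cong)
    fix t
    have "emeasure m ({Y t} \<inter> A) = 0"
      using atoms by (cases "Y t \<in> A") auto
    then show "(\<integral>\<^sup>+ x. indicator ({Y t} \<inter> A) x \<partial>m) = 0" by (simp add: sets_m)
  qed
  finally show ?thesis by simp
qed

lemma integrable_kernel:
  assumes s: "s > 0" and b: "b \<ge> 0"
  shows "integrable m (\<lambda>x. (1 + (s - 1) * x) powr - b)"
proof (rule m.integrable_const_bound[where B = "min s 1 powr - b"])
  show "AE x in m. norm ((1 + (s - 1) * x) powr - b) \<le> min s 1 powr - b"
    using m01 by eventually_elim (use powr_affine_bound[OF s b] in simp)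
qed measurable

lemma Y_affine_pos: "s > 0 \<Longrightarrow> 0 < 1 + (s - 1) * Y t"
  using affine_pos[of s "Y t"] Y01[of t] by simp

lemma integrable_Y:
  assumes s: "s > 0"
  shows "integrable p (\<lambda>t. 1 / (1 + (s - 1) * Y t))"
proof -
  have "1 / (1 + (s - 1) * Y t) \<le> 1 / min s 1" for t
    using affine_lower_bound[of "Y t" s] Y01[of t] s by (intro divide_left_mono mult_pos_pos Y_affine_pos) auto
  then show ?thesis
    by (intro p.integrable_const_bound[where B = "1 / min s 1"])
       (use Y_affine_pos[OF s] in \<open>auto simp: less_imp_le\<close>)
qed

definition G :: "real \<Rightarrow> real" where
  "G s = (\<integral>x. (1 + (s - 1) * x) powr - \<rho> \<partial>m)"

lemma nn_integral_kernel:
  "s > 0 \<Longrightarrow> (\<integral>\<^sup>+ x. ennreal ((1 + (s - 1) * x) powr - \<rho>) \<partial>m) = ennreal (G s)"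
  unfolding G_def using \<rho> by (intro nn_integral_eq_integral integrable_kernel) auto

lemma G_pos:
  assumes s: "s > 0"
  shows "G s > 0"
proof -
  have "(\<integral>x. max s 1 powr - \<rho> \<partial>m) \<le> G s"
    unfolding G_def
  proof (rule integral_mono_AE)
    show "AE x in m. max s 1 powr - \<rho> \<le> (1 + (s - 1) * x) powr - \<rho>"
      using m01
    proof eventually_elim
      case (elim x)
      have "(1 - x) * 1 + x * s \<le> (1 - x) * max s 1 + x * max s 1"
        using elim by (intro add_mono mult_left_mono) auto
      then have "1 + (s - 1) * x \<le> max s 1" by (simp add: algebra_simps)
      then show ?case using affine_pos[OF s elim] \<rho> by (intro powr_mono2') auto
    qed
  qed (use integrable_kernel[OF s] \<rho> in auto)
  moreover have "(\<integral>x. max s 1 powr - \<rho> \<partial>m) = max s 1 powr - \<rho>"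
    by (simp add: m.prob_space)
  moreover have "max s 1 powr - \<rho> > 0" using s by simp
  ultimately show ?thesis by linarith
qed

text \<open>An affine function commutes with convex combinations, so the fixed point equation for
  w^(-\<rho>-1) becomes Feynman's integral with endpoints w(\<open>Y t\<close>) and w(x). Its value
  is a function of t times a function of x, hence the product.\<close>

lemma integral_kernel_Suc:
  assumes s: "s > 0"
  shows "(\<integral>x. (1 + (s - 1) * x) powr - (\<rho> + 1) \<partial>m) = G s * (\<integral>t. 1 / (1 + (s - 1) * Y t) \<partial>p)"
proof -
  let ?w = "\<lambda>x. 1 + (s - 1) * x"
  have "(\<integral>\<^sup>+ x. ennreal (?w x powr - (\<rho> + 1)) \<partial>m) = (\<integral>\<^sup>+ t. \<integral>\<^sup>+ x. \<integral>\<^sup>+ r.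
        ennreal (((1 - r powr (1 / \<rho>)) * ?w (Y t) + r powr (1 / \<rho>) * ?w x) powr - (\<rho> + 1)) \<partial>unif \<partial>m \<partial>p)"
    by (subst fixed_point) (auto simp: algebra_simps)
  also have "\<dots> = (\<integral>\<^sup>+ t. \<integral>\<^sup>+ x. ennreal (1 / ?w (Y t)) * ennreal (?w x powr - \<rho>) \<partial>m \<partial>p)"
  proof (rule nn_integral_cong, rule nn_integral_cong_AE)
    fix t
    show "AE x in m. (\<integral>\<^sup>+ r. ennreal (((1 - r powr (1 / \<rho>)) * ?w (Y t) + r powr (1 / \<rho>) * ?w x) powr - (\<rho> + 1)) \<partial>unif)
        = ennreal (1 / ?w (Y t)) * ennreal (?w x powr - \<rho>)"
      using m01
    proof eventually_elim
      case (elim x)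
      show ?case
        using Y_affine_pos[OF s, of t]
        by (subst feynman_parametrization[OF affine_pos[OF s elim] Y_affine_pos[OF s] \<rho>])
           (simp add: ennreal_mult[symmetric])
    qed
  qed
  also have "\<dots> = (\<integral>\<^sup>+ t. ennreal (1 / ?w (Y t)) \<partial>p) * ennreal (G s)"
    by (simp add: nn_integral_cmult nn_integral_multc nn_integral_kernel[OF s] del: ennreal_1)
  also have "(\<integral>\<^sup>+ t. ennreal (1 / ?w (Y t)) \<partial>p) = ennreal (\<integral>t. 1 / ?w (Y t) \<partial>p)"
    using Y_affine_pos[OF s] by (intro nn_integral_eq_integral integrable_Y[OF s]) (auto simp: less_imp_le)
  also have "(\<integral>\<^sup>+ x. ennreal (?w x powr - (\<rho> + 1)) \<partial>m) = ennreal (\<integral>x. ?w x powr - (\<rho> + 1) \<partial>m)"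
    using \<rho> by (intro nn_integral_eq_integral integrable_kernel[OF s]) auto
  also have "ennreal (\<integral>t. 1 / ?w (Y t) \<partial>p) * ennreal (G s) = ennreal ((\<integral>t. 1 / ?w (Y t) \<partial>p) * G s)"
    using G_pos[OF s] by (simp add: ennreal_mult'')
  finally show ?thesis
    using G_pos[OF s] Y_affine_pos[OF s]
    by (subst (asm) ennreal_inj) (auto intro!: integral_nonneg_AE mult_nonneg_nonneg simp: less_imp_le mult.commute)
qed

text \<open>Near s the parameter stays above s/2, which bounds the differentiated kernel by a
  constant. The point s = 1 is included, which later yields continuity of \<open>G\<close>
  there.\<close>

lemma DERIV_G_moment:
  assumes s: "s > 0"
  shows "(G has_real_derivative - \<rho> * (\<integral>x. x * (1 + (s - 1) * x) powr - (\<rho> + 1) \<partial>m)) (at s)"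
proof -
  have "((\<lambda>s. \<integral>x. (1 + (s - 1) * x) powr - \<rho> \<partial>m) has_real_derivative
      (\<integral>x. - \<rho> * (x * (1 + (s - 1) * x) powr - (\<rho> + 1)) \<partial>m)) (at s)"
  proof (rule has_real_derivative_integral[where e = "s / 2" and w = "\<lambda>_. \<rho> * min (s / 2) 1 powr - (\<rho> + 1)"])
    have pos: "s' > 0" if "\<bar>s' - s\<bar> < s / 2" for s' using that s by (auto simp: abs_if field_simps split: if_splits)
    show "integrable m (\<lambda>x. (1 + (s' - 1) * x) powr - \<rho>)" if "\<bar>s' - s\<bar> < s / 2" for s'
      using integrable_kernel[OF pos[OF that], of \<rho>] \<rho> by simp
    show "AE x in m. \<forall>s'. \<bar>s' - s\<bar> < s / 2 \<longrightarrow>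
        ((\<lambda>s. (1 + (s - 1) * x) powr - \<rho>) has_real_derivative
          - \<rho> * (x * (1 + (s' - 1) * x) powr - (\<rho> + 1))) (at s')"
      using m01
    proof (eventually_elim, intro allI impI)
      fix x s' assume x: "x \<in> {0..1::real}" and s': "\<bar>s' - s\<bar> < s / 2"
      have "((\<lambda>s. 1 + (s - 1) * x) has_real_derivative x) (at s')"
        by (auto intro!: derivative_eq_intros)
      from DERIV_chain2[OF has_real_derivative_powr[OF affine_pos[OF pos[OF s'] x]] this, of "- \<rho>"]
      show "((\<lambda>s. (1 + (s - 1) * x) powr - \<rho>) has_real_derivative
          - \<rho> * (x * (1 + (s' - 1) * x) powr - (\<rho> + 1))) (at s')"
        by (simp add: mult_ac)
    qed
    show "AE x in m. \<forall>s'. \<bar>s' - s\<bar> < s / 2 \<longrightarrow>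
        \<bar>- \<rho> * (x * (1 + (s' - 1) * x) powr - (\<rho> + 1))\<bar> \<le> \<rho> * min (s / 2) 1 powr - (\<rho> + 1)"
      using m01
    proof (eventually_elim, intro allI impI)
      fix x s' assume x: "x \<in> {0..1::real}" and s': "\<bar>s' - s\<bar> < s / 2"
      have "x * (1 + (s' - 1) * x) powr - (\<rho> + 1) \<le> (1 + (s' - 1) * x) powr - (\<rho> + 1)"
        using x by (intro mult_left_le_one_le) auto
      also have "\<dots> \<le> min s' 1 powr - (\<rho> + 1)"
        by (rule powr_affine_bound[OF pos[OF s'] _ x]) (use \<rho> in simp)
      also have "\<dots> \<le> min (s / 2) 1 powr - (\<rho> + 1)"
        using s' s \<rho> by (intro powr_mono2') (auto simp: abs_if min_def field_simps split: if_splits)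
      finally show "\<bar>- \<rho> * (x * (1 + (s' - 1) * x) powr - (\<rho> + 1))\<bar> \<le> \<rho> * min (s / 2) 1 powr - (\<rho> + 1)"
        using \<rho> x by (simp add: abs_mult)
    qed
  qed (use s in auto)
  moreover have "G = (\<lambda>s. \<integral>x. (1 + (s - 1) * x) powr - \<rho> \<partial>m)" by (simp add: G_def fun_eq_iff)
  ultimately show ?thesis by simp
qed

text \<open>Multiplying by \<open>s - 1\<close> turns both sides into differences of integrals covered by
  \<open>integral_kernel_Suc\<close>; this is why \<open>s = 1\<close> is excluded.\<close>

lemma DERIV_G:
  assumes s: "s > 0" "s \<noteq> 1"
  shows "(G has_real_derivative - \<rho> * (\<integral>t. Y t / (1 + (s - 1) * Y t) \<partial>p) * G s) (at s)"
proof -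
  let ?h = "s - 1"
  let ?I = "\<integral>x. (1 + ?h * x) powr - (\<rho> + 1) \<partial>m"
  have "?h * (\<integral>x. x * (1 + ?h * x) powr - (\<rho> + 1) \<partial>m)
      = (\<integral>x. ?h * (x * (1 + ?h * x) powr - (\<rho> + 1)) \<partial>m)" by simp
  also have "\<dots> = (\<integral>x. (1 + ?h * x) powr - \<rho> - (1 + ?h * x) powr - (\<rho> + 1) \<partial>m)"
  proof (rule integral_cong_AE)
    show "AE x in m. ?h * (x * (1 + ?h * x) powr - (\<rho> + 1))
        = (1 + ?h * x) powr - \<rho> - (1 + ?h * x) powr - (\<rho> + 1)"
      using m01
    proof eventually_elim
      case (elim x)
      have "(1 + ?h * x) powr - \<rho> = (1 + ?h * x) powr (- (\<rho> + 1) + 1)" by simp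
      also have "\<dots> = (1 + ?h * x) powr - (\<rho> + 1) * (1 + ?h * x)"
        using affine_pos[OF s(1) elim] by (subst powr_add) simp
      finally show ?case by (simp add: algebra_simps)
    qed
  qed measurable
  also have "\<dots> = G s - ?I"
    unfolding G_def using \<rho> by (intro Bochner_Integration.integral_diff integrable_kernel[OF s(1)]) auto
  also have "\<dots> = G s * (1 - (\<integral>t. 1 / (1 + ?h * Y t) \<partial>p))"
    unfolding integral_kernel_Suc[OF s(1)] by (simp add: algebra_simps)
  also have "1 - (\<integral>t. 1 / (1 + ?h * Y t) \<partial>p) = (\<integral>t. 1 - 1 / (1 + ?h * Y t) \<partial>p)"
    using integrable_Y[OF s(1)] by (subst Bochner_Integration.integral_diff) (auto simp: p.prob_space)
  also have "\<dots> = (\<integral>t. ?h * (Y t / (1 + ?h * Y t)) \<partial>p)"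
    by (intro Bochner_Integration.integral_cong refl)
       (use Y_affine_pos[OF s(1)] in \<open>simp add: field_simps less_imp_neq[symmetric]\<close>)
  also have "\<dots> = ?h * (\<integral>t. Y t / (1 + ?h * Y t) \<partial>p)" by (rule integral_mult_right_zero)
  finally have "?h * (\<integral>x. x * (1 + ?h * x) powr - (\<rho> + 1) \<partial>m)
      = ?h * ((\<integral>t. Y t / (1 + ?h * Y t) \<partial>p) * G s)"
    by (simp only: mult_ac)
  then have "(\<integral>x. x * (1 + ?h * x) powr - (\<rho> + 1) \<partial>m) = (\<integral>t. Y t / (1 + ?h * Y t) \<partial>p) * G s"
    by (subst (asm) mult_left_cancel) (use s(2) in auto)
  with DERIV_G_moment[OF s(1)] show ?thesis by (simp add: mult.assoc)
qed

text \<open>The logarithmic derivatives of \<open>\<phi>\<close> and \<open>G\<close> agree away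
  from s = 1, so the quotient has derivative 0 there. Its continuity at 1 forces the same constant
  on both sides.\<close>

lemma eq_const_mult_G:
  assumes \<phi>: "\<And>s. s > 0 \<Longrightarrow>
    (\<phi> has_real_derivative - \<rho> * (\<integral>t. Y t / (1 + (s - 1) * Y t) \<partial>p) * \<phi> s) (at s)"
  shows "\<exists>C. \<forall>s>0. \<phi> s = C * G s"
proof -
  obtain C where C: "\<And>s. s \<in> {0<..} \<Longrightarrow> \<phi> s / G s = C"
  proof (rule DERIV_zero_connected_constant[of "{0<..}" "{1}" "\<lambda>s. \<phi> s / G s"])
    show "continuous_on {0<..} (\<lambda>s. \<phi> s / G s)"
      using G_pos by (intro continuous_on_divide DERIV_continuous_on[where f = \<phi>] DERIV_continuous_on[where f = G])
        (auto intro!: DERIV_subset[OF \<phi>] DERIV_subset[OF DERIV_G_moment] simp: less_imp_neq[symmetric])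
    show "\<forall>s\<in>{0<..} - {1}. ((\<lambda>s. \<phi> s / G s) has_real_derivative 0) (at s)"
    proof
      fix s :: real assume s: "s \<in> {0<..} - {1}"
      have "G s \<noteq> 0" using G_pos[of s] s by auto
      from DERIV_divide[OF \<phi>[of s] DERIV_G[of s] this] s
      show "((\<lambda>s. \<phi> s / G s) has_real_derivative 0) (at s)" by simp
    qed
  qed auto
  show ?thesis
    by (rule exI[of _ C]) (use C G_pos in \<open>force simp: field_simps\<close>)
qed

section \<open>The Stieltjes representation of \<open>C * G s\<close> and its singular part\<close>

text \<open>Since \<open>0 powr - \<rho> = 0\<close>, the density discards the atom of \<open>m\<close> at \<open>0\<close>, which corresponds
  to \<open>t = \<infinity>\<close>.\<close>

definition stieltjes_measure :: "real \<Rightarrow> real measure" where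
  "stieltjes_measure C = distr (density m (\<lambda>x. ennreal (C * x powr - \<rho>))) borel (\<lambda>x. 1 / x - 1)"

lemma nn_integral_stieltjes_measure:
  assumes [measurable]: "g \<in> borel_measurable borel"
  shows "(\<integral>\<^sup>+ t. g t \<partial>stieltjes_measure C) = (\<integral>\<^sup>+ x. ennreal (C * x powr - \<rho>) * g (1 / x - 1) \<partial>m)"
  unfolding stieltjes_measure_def
  by (subst nn_integral_distr, measurable, subst nn_integral_density) auto

lemma emeasure_stieltjes_measure:
  assumes "A \<in> sets borel"
  shows "emeasure (stieltjes_measure C) A = (\<integral>\<^sup>+ x. ennreal (C * x powr - \<rho>) * indicator A (1 / x - 1) \<partial>m)"
  using nn_integral_stieltjes_measure[of "indicator A" C] assms
  by (simp add: stieltjes_measure_def)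

text \<open>For x > 0 and t = 1/x - 1 one has 1 + (s - 1) x = x (s + t), so the power factors into
  density and kernel. At x = 0 the left side is 1 for every s, which produces the constant
  term.\<close>

lemma S_transform_stieltjes_measure:
  assumes s: "s > 0" and C: "C \<ge> 0"
  shows "ennreal (C * measure m {0}) + S_transform \<rho> (stieltjes_measure C) s = ennreal (C * G s)"
proof -
  have "ennreal (C * G s) = (\<integral>\<^sup>+ x. ennreal C * ennreal ((1 + (s - 1) * x) powr - \<rho>) \<partial>m)"
    using C s by (simp add: nn_integral_cmult nn_integral_kernel ennreal_mult')
  also have "\<dots> = (\<integral>\<^sup>+ x. ennreal C * indicator {0} x
      + ennreal (C * x powr - \<rho>) * ennreal ((s + (1 / x - 1)) powr - \<rho>) \<partial>m)"
  proof (rule nn_integral_cong_AE)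
    show "AE x in m. ennreal C * ennreal ((1 + (s - 1) * x) powr - \<rho>) = ennreal C * indicator {0} x
      + ennreal (C * x powr - \<rho>) * ennreal ((s + (1 / x - 1)) powr - \<rho>)"
      using m01
    proof eventually_elim
      case (elim x)
      show ?case
      proof (cases "x = 0")
        case False
        then have x: "x > 0" using elim by simp
        have "1 + (s - 1) * x = x * (s + (1 / x - 1))" using x by (simp add: field_simps)
        moreover have "1 \<le> 1 / x" using x elim by simp
        then have "s + (1 / x - 1) \<ge> 0" using s by linarith
        ultimately have "(1 + (s - 1) * x) powr - \<rho> = x powr - \<rho> * (s + (1 / x - 1)) powr - \<rho>"
          using x by (simp add: powr_mult)
        then show ?thesis using x C by (simp add: ennreal_mult[symmetric] mult.assoc)
      qed simp
    qed
  qed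
  also have "\<dots> = ennreal C * emeasure m {0}
      + (\<integral>\<^sup>+ x. ennreal (C * x powr - \<rho>) * ennreal ((s + (1 / x - 1)) powr - \<rho>) \<partial>m)"
    by (subst nn_integral_add) (auto simp: nn_integral_cmult sets_m)
  also have "\<dots> = ennreal (C * measure m {0}) + S_transform \<rho> (stieltjes_measure C) s"
    unfolding S_transform_def using C
    by (subst nn_integral_stieltjes_measure) (auto simp: m.emeasure_eq_measure ennreal_mult)
  finally show ?thesis ..
qed

lemma stieltjes_rep_G:
  assumes C: "C \<ge> 0"
  shows "stieltjes_rep \<rho> (C * measure m {0}) (stieltjes_measure C) (\<lambda>s. C * G s)"
  unfolding stieltjes_rep_def M_plus_def
proof (intro conjI CollectI allI impI)
  show "emeasure (stieltjes_measure C) {..<0} = 0"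
  proof (subst emeasure_stieltjes_measure, simp)
    have "(\<integral>\<^sup>+ x. ennreal (C * x powr - \<rho>) * indicator {..<0} (1 / x - 1) \<partial>m) = (\<integral>\<^sup>+ x. 0 \<partial>m)"
    proof (rule nn_integral_cong_AE)
      show "AE x in m. ennreal (C * x powr - \<rho>) * indicator {..<0} (1 / x - 1) = 0"
        using m01
      proof eventually_elim
        case (elim x)
        \<comment> \<open>The point x = 0 is sent to -1 by the convention 1/0 = 0, but its density
          is 0.\<close>
        then have "x = 0 \<or> 1 \<le> 1 / x" by (cases "x = 0") auto
        then show ?case by (auto simp: indicator_def)
      qed
    qed
    then show "(\<integral>\<^sup>+ x. ennreal (C * x powr - \<rho>) * indicator {..<0} (1 / x - 1) \<partial>m) = 0" by simp
  qed
  \<comment> \<open>The finiteness condition in \<open>M_plus\<close> is the transform at s =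
    1.\<close>
  have "ennreal (C * measure m {0}) + S_transform \<rho> (stieltjes_measure C) 1 < \<infinity>"
    by (subst S_transform_stieltjes_measure) (use C in auto)
  then show "(\<integral>\<^sup>+ t. ennreal ((1 + t) powr - \<rho>) \<partial>stieltjes_measure C) < \<infinity>"
    by (auto simp: S_transform_def less_top)
  fix s :: real assume s: "s > 0"
  show "0 \<le> C * G s" using C G_pos[OF s] by simp
  show "ennreal (C * G s) = ennreal (C * measure m {0}) + S_transform \<rho> (stieltjes_measure C) s"
    using S_transform_stieltjes_measure[OF s C] by simp
qed (use C in \<open>auto simp: stieltjes_measure_def\<close>)

text \<open>The change of variables x = 1/(1 + t) preserves null sets, and atoms of \<open>m\<close>
  in (0,1] become atoms of the image measure. Hence a null set without atoms pulls back to one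
  covered by \<open>null_set_if_no_atoms\<close>.\<close>

lemma no_singular_continuous_part_stieltjes_measure:
  assumes C: "C > 0"
  shows "no_singular_continuous_part (stieltjes_measure C)"
  unfolding no_singular_continuous_part_def
proof (intro ballI impI)
  let ?\<mu> = "stieltjes_measure C"
  fix A :: "real set" assume A: "A \<in> sets borel" "emeasure lborel A = 0"
  define A' where "A' = A - {x. emeasure ?\<mu> {x} \<noteq> 0}"
  show "emeasure ?\<mu> A' = 0"
  \<comment> \<open>A set that is not measurable has \<open>emeasure\<close> 0 by convention, so
    measurability of the set of atoms need not be shown.\<close>
  proof (cases "A' \<in> sets borel")
    case False
    then show ?thesis by (intro emeasure_notin_sets) (simp add: stieltjes_measure_def)
  next
    case True
    note [measurable] = True
    define B where "B = {x \<in> {0<..1}. 1 / x - 1 \<in> A'}"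
    have B[measurable]: "B \<in> sets borel" unfolding B_def by measurable
    have "A \<in> null_sets lborel" using A by auto
    then have "negligible A" by (simp add: negligible_iff_null_sets null_sets_completionI)
    then have "negligible (A' \<inter> {0..})" by (rule negligible_subset) (auto simp: A'_def)
    moreover have "(\<lambda>t. 1 / (1 + t)) differentiable_on (A' \<inter> {0..})"
      by (intro differentiable_at_imp_differentiable_on derivative_intros) auto
    ultimately have "negligible ((\<lambda>t. 1 / (1 + t)) ` (A' \<inter> {0..}))"
      by (intro negligible_differentiable_image_negligible) auto
    moreover have "B \<subseteq> (\<lambda>t. 1 / (1 + t)) ` (A' \<inter> {0..})"
    proof
      fix x assume "x \<in> B"
      then show "x \<in> (\<lambda>t. 1 / (1 + t)) ` (A' \<inter> {0..})"
        by (intro image_eqI[of _ _ "1 / x - 1"]) (auto simp: B_def field_simps)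
    qed
    ultimately have "negligible B" using negligible_subset by blast
    with B have nB: "B \<in> null_sets lborel"
      by (simp add: negligible_iff_null_sets null_sets_def)
    \<comment> \<open>The density is positive at x, so an atom of \<open>m\<close> there would be an
      atom at 1/x - 1, which \<open>A'\<close> excludes.\<close>
    have "emeasure m {x} = 0" if x: "x \<in> B" for x
    proof -
      have x0: "x > 0" using x by (simp add: B_def)
      have "ennreal (C * x powr - \<rho>) * emeasure m {x} = (\<integral>\<^sup>+ y. ennreal (C * x powr - \<rho>) * indicator {x} y \<partial>m)"
        by (simp add: nn_integral_cmult sets_m)
      also have "\<dots> \<le> (\<integral>\<^sup>+ y. ennreal (C * y powr - \<rho>) * indicator {1 / x - 1} (1 / y - 1) \<partial>m)"
        by (intro nn_integral_mono) (auto split: split_indicator)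
      also have "\<dots> = emeasure ?\<mu> {1 / x - 1}" by (simp add: emeasure_stieltjes_measure)
      also have "\<dots> = 0" using x by (simp add: B_def A'_def)
      finally have "ennreal (C * x powr - \<rho>) * emeasure m {x} = 0" by simp
      moreover have "C * x powr - \<rho> > 0" using x0 C by simp
      ultimately show ?thesis by (simp add: ennreal_eq_0_iff not_le)
    qed
    with null_set_if_no_atoms[OF nB] have "B \<in> null_sets m" by (auto simp: null_sets_def sets_m)
    then have "AE x in m. x \<notin> B" by (rule AE_not_in)
    then have "(\<integral>\<^sup>+ x. ennreal (C * x powr - \<rho>) * indicator A' (1 / x - 1) \<partial>m) = (\<integral>\<^sup>+ x. 0 \<partial>m)"
      using m01 by (intro nn_integral_cong_AE, eventually_elim) (auto simp: B_def indicator_def)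
    then show ?thesis using True by (simp add: emeasure_stieltjes_measure)
  qed
qed

end

section \<open>Total mass from the limit condition, and assembly of the proof\<close>

lemma stieltjes_rep_cong:
  assumes "\<And>s. s > 0 \<Longrightarrow> g s = h s"
  shows "stieltjes_rep \<rho> a \<mu> g \<longleftrightarrow> stieltjes_rep \<rho> a \<mu> h"
  using assms by (simp add: stieltjes_rep_def)

text \<open>The constant is a lower bound for \<open>\<Psi> s\<close>, which tends to 0 because s
  \<open>\<Psi> s\<close> converges. With b = 0, the kernel s/(s + t) increases to 1 and monotone
  convergence identifies the limit with the total mass.\<close>

lemma stieltjes_rep_1_limit:
  assumes rep: "stieltjes_rep 1 b \<nu> \<Psi>" and lim: "((\<lambda>s. s * \<Psi> s) \<longlongrightarrow> \<gamma>) at_top"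
  shows "b = 0" "\<gamma> \<ge> 0" "emeasure \<nu> (space \<nu>) = ennreal \<gamma>"
proof -
  have \<nu>: "\<nu> \<in> M_plus 1" and b: "b \<ge> 0" and
    \<Psi>: "\<And>s. s > 0 \<Longrightarrow> \<Psi> s \<ge> 0 \<and> ennreal (\<Psi> s) = ennreal b + S_transform 1 \<nu> s"
    using rep by (auto simp: stieltjes_rep_def)
  note [measurable_cong] = M_plus_sets[OF \<nu>]
  have b_le: "b \<le> \<Psi> s" if "s > 0" for s
  proof -
    have "ennreal b \<le> ennreal (\<Psi> s)" using \<Psi>[OF that] by simp
    then show ?thesis by (subst (asm) ennreal_le_iff) (use \<Psi>[OF that] in auto)
  qed
  have "((\<lambda>s. s * \<Psi> s * inverse s) \<longlongrightarrow> \<gamma> * 0) at_top"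
    by (intro tendsto_mult lim tendsto_inverse_0_at_top filterlim_ident)
  then have "b \<le> \<gamma> * 0"
    by (rule tendsto_lowerbound)
       (auto intro!: eventually_mono[OF eventually_gt_at_top[of 0]] simp: b_le divide_inverse[symmetric])
  with b show b0: "b = 0" by simp
  show "\<gamma> \<ge> 0"
    by (rule tendsto_lowerbound[OF lim])
       (auto intro!: eventually_mono[OF eventually_gt_at_top[of 0]] simp: \<Psi>)
  \<comment> \<open>Replacing t by \<open>max 0 t\<close> makes the sequence monotone at every real
    t and changes nothing almost everywhere.\<close>
  let ?f = "\<lambda>n t. ennreal (real (Suc n) / (real (Suc n) + max 0 t))"
  have eq: "ennreal (real (Suc n) * \<Psi> (real (Suc n))) = (\<integral>\<^sup>+ t. ?f n t \<partial>\<nu>)" for n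
  proof -
    have "ennreal (real (Suc n) * \<Psi> (real (Suc n)))
        = ennreal (real (Suc n)) * (\<integral>\<^sup>+ t. ennreal ((real (Suc n) + t) powr - 1) \<partial>\<nu>)"
      using \<Psi>[of "real (Suc n)"] b0 by (subst ennreal_mult) (auto simp: S_transform_def)
    also have "\<dots> = (\<integral>\<^sup>+ t. ennreal (real (Suc n)) * ennreal ((real (Suc n) + t) powr - 1) \<partial>\<nu>)"
      by (subst nn_integral_cmult) auto
    also have "\<dots> = (\<integral>\<^sup>+ t. ?f n t \<partial>\<nu>)"
      using M_plus_AE_nonneg[OF \<nu>]
      by (intro nn_integral_cong_AE, eventually_elim)
         (simp add: ennreal_mult[symmetric] powr_minus divide_inverse del: of_nat_Suc)
    finally show ?thesis .
  qed
  have l1: "(\<lambda>n. \<integral>\<^sup>+ t. ?f n t \<partial>\<nu>) \<longlonglongrightarrow> (\<integral>\<^sup>+ t. ennreal 1 \<partial>\<nu>)"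
  proof (rule nn_integral_LIMSEQ)
    show "incseq ?f"
      by (intro incseq_SucI le_funI ennreal_leI) (simp add: field_simps)
    fix t :: real
    have "(\<lambda>n. real (Suc n) / (real (Suc n) + max 0 t)) \<longlonglongrightarrow> 1" by real_asymp
    then show "(\<lambda>n. ?f n t) \<longlonglongrightarrow> ennreal 1" by (rule tendsto_ennrealI)
  qed measurable
  have l2: "(\<lambda>n. ennreal (real (Suc n) * \<Psi> (real (Suc n)))) \<longlonglongrightarrow> ennreal \<gamma>"
    using filterlim_compose[OF lim filterlim_compose[OF filterlim_real_sequentially filterlim_Suc]]
    by (rule tendsto_ennrealI)
  show "emeasure \<nu> (space \<nu>) = ennreal \<gamma>"
    using LIMSEQ_unique[OF l1 l2[unfolded eq]] by simp
qed

theorem theorem6p3: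
  fixes f :: "real \<Rightarrow> real" and \<gamma> :: real
  assumes pos: "\<forall>s>0. f s > 0"
    and diff: "\<forall>s>0. f differentiable (at s)"
    and Psi: "(\<lambda>s. - deriv f s / f s) \<in> gen_stieltjes 1"
    and lim: "((\<lambda>s. s * (- deriv f s / f s)) \<longlongrightarrow> \<gamma>) at_top"
  shows "\<forall>\<alpha>>0. (\<lambda>s. f s powr \<alpha>) \<in> gen_stieltjes (\<gamma> * \<alpha>) \<and>
           (\<gamma> > 0 \<longrightarrow> (\<forall>a \<mu>. stieltjes_rep (\<gamma> * \<alpha>) a \<mu> (\<lambda>s. f s powr \<alpha>)
                          \<longrightarrow> no_singular_continuous_part \<mu>))"
proof (intro allI impI)
  fix \<alpha> :: real assume \<alpha>: "\<alpha> > 0"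
  define \<Psi> where "\<Psi> s = - deriv f s / f s" for s
  obtain b \<nu> where rep: "stieltjes_rep 1 b \<nu> \<Psi>"
    using Psi by (auto simp: gen_stieltjes_def \<Psi>_def[abs_def])
  have "((\<lambda>s. s * \<Psi> s) \<longlongrightarrow> \<gamma>) at_top" using lim by (simp add: \<Psi>_def)
  note limit = stieltjes_rep_1_limit[OF rep this]
  have \<nu>: "\<nu> \<in> M_plus 1" using rep by (simp add: stieltjes_rep_def)
  note [measurable_cong] = M_plus_sets[OF \<nu>]
  have \<Psi>: "\<Psi> s = (\<integral>t. 1 / (s + t) \<partial>\<nu>)" if s: "s > 0" for s
  proof -
    have "\<Psi> s = (\<integral>t. (s + t) powr - 1 \<partial>\<nu>)"
      using stieltjes_rep_eq_integral[OF rep _ s] limit(1) by simp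
    also have "\<dots> = (\<integral>t. 1 / (s + t) \<partial>\<nu>)"
      using M_plus_AE_nonneg[OF \<nu>] s
      by (intro integral_cong_AE) (auto elim!: eventually_mono simp: powr_minus_divide)
    finally show ?thesis .
  qed
  have f': "(f has_real_derivative - \<Psi> s * f s) (at s)" if s: "s > 0" for s
    using diff pos s DERIV_deriv_iff_real_differentiable[of f s] by (force simp: \<Psi>_def)
  show "(\<lambda>s. f s powr \<alpha>) \<in> gen_stieltjes (\<gamma> * \<alpha>) \<and>
           (\<gamma> > 0 \<longrightarrow> (\<forall>a \<mu>. stieltjes_rep (\<gamma> * \<alpha>) a \<mu> (\<lambda>s. f s powr \<alpha>)
                          \<longrightarrow> no_singular_continuous_part \<mu>))"
  proof (cases "\<gamma> = 0")
    case True
    \<comment> \<open>The measure has mass 0, so f is constant and serves as its own constant term.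
      The order is 0 here: the kernel is 1 and representations are not unique, hence the restriction
      of the second claim to positive \<open>\<gamma>\<close>.\<close>
    have "AE t in \<nu>. False"
      using limit(3) True by (subst AE_iff_measurable[OF _ refl]) auto
    then have "\<Psi> s = 0" if "s > 0" for s
      unfolding \<Psi>[OF that] by (subst integral_cong_AE[where g = "\<lambda>_. 0"]) auto
    then have "f constant_on {0<..}"
      using f' by (intro has_field_derivative_0_imp_constant_on) force+
    then obtain c where c: "\<And>s. s > 0 \<Longrightarrow> f s = c" by (auto simp: constant_on_def)
    have "stieltjes_rep (\<gamma> * \<alpha>) (c powr \<alpha>) (null_measure borel) (\<lambda>s. f s powr \<alpha>)"
      using c by (auto simp: stieltjes_rep_def M_plus_def S_transform_def)
    then show ?thesis using True by (auto simp: gen_stieltjes_def)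
  next
    case False
    then have \<gamma>: "\<gamma> > 0" using limit(2) by simp
    define \<rho> where "\<rho> = \<gamma> * \<alpha>"
    have \<rho>: "\<rho> > 0" using \<gamma> \<alpha> by (simp add: \<rho>_def)
    define p where "p = density \<nu> (\<lambda>_. ennreal (1 / \<gamma>))"
    \<comment> \<open>The maximum keeps \<open>Y\<close> in (0,1] on the whole line;
      \<open>\<nu>\<close> only sees t \<ge> 0.\<close>
    define Y :: "real \<Rightarrow> real" where "Y t = 1 / (1 + max 0 t)" for t
    have "prob_space p"
    proof
      show "emeasure p (space p) = 1"
        unfolding p_def using limit(3) \<gamma>
        by (subst emeasure_density) (auto simp: nn_integral_cmult ennreal_mult[symmetric])
    qed
    moreover have [measurable]: "Y \<in> borel_measurable p" unfolding p_def Y_def by measurable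
    moreover have Y01: "0 < Y t \<and> Y t \<le> 1" for t by (auto simp: Y_def)
    ultimately obtain m where "dirichlet_mean p m \<rho> Y"
      using dirichlet_mean_exists[OF _ _ _ \<rho>] by metis
    then interpret dirichlet_mean p m \<rho> Y .
    have \<Psi>Y: "\<Psi> s = \<gamma> * (\<integral>t. Y t / (1 + (s - 1) * Y t) \<partial>p)" if s: "s > 0" for s
    proof -
      have "(\<integral>t. Y t / (1 + (s - 1) * Y t) \<partial>p) = (\<integral>t. (1 / \<gamma>) *\<^sub>R (Y t / (1 + (s - 1) * Y t)) \<partial>\<nu>)"
        unfolding p_def Y_def using \<gamma> by (intro integral_density) auto
      then have "\<gamma> * (\<integral>t. Y t / (1 + (s - 1) * Y t) \<partial>p) = (\<integral>t. Y t / (1 + (s - 1) * Y t) \<partial>\<nu>)"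
        unfolding integral_scaleR_right using \<gamma> by simp
      also have "\<dots> = (\<integral>t. 1 / (s + t) \<partial>\<nu>)"
      proof (rule integral_cong_AE)
        show "AE t in \<nu>. Y t / (1 + (s - 1) * Y t) = 1 / (s + t)"
          using M_plus_AE_nonneg[OF \<nu>]
        proof eventually_elim
          case (elim t)
          have "1 + (s - 1) * Y t = (s + t) / (1 + t)" using elim by (simp add: Y_def field_simps)
          then show ?case using elim s by (simp add: Y_def)
        qed
      qed (auto simp: Y_def)
      finally show ?thesis using \<Psi>[OF s] by simp
    qed
    have "((\<lambda>s. f s powr \<alpha>) has_real_derivative
        - \<rho> * (\<integral>t. Y t / (1 + (s - 1) * Y t) \<partial>p) * f s powr \<alpha>) (at s)" if s: "s > 0" for s
    proof -
      have "f s > 0" using pos s by simp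
      then have "f s powr (\<alpha> - 1) * f s = f s powr \<alpha>" by (simp add: powr_diff)
      \<comment> \<open>The factor \<open>\<gamma>\<close> from the normalisation of
        \<open>\<nu>\<close> combines with \<open>\<alpha>\<close> to give \<open>\<rho>\<close>,
        matching the logarithmic derivative of \<open>G\<close>.\<close>
      then have "\<alpha> * f s powr (\<alpha> - 1) * (- \<Psi> s * f s) = - \<rho> * (\<integral>t. Y t / (1 + (s - 1) * Y t) \<partial>p) * f s powr \<alpha>"
        unfolding \<Psi>Y[OF s] \<rho>_def by (simp add: mult_ac)
      with DERIV_chain2[OF has_real_derivative_powr[OF \<open>f s > 0\<close>] f'[OF s], of \<alpha>] show ?thesis by simp
    qed
    then obtain C where C: "\<And>s. s > 0 \<Longrightarrow> f s powr \<alpha> = C * G s"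
      using eq_const_mult_G[of "\<lambda>s. f s powr \<alpha>"] by blast
    have "C * G 1 > 0" using pos[rule_format, of 1] by (simp flip: C)
    then have C0: "C > 0" using G_pos[of 1] by (simp add: zero_less_mult_iff)
    have cong: "stieltjes_rep \<rho> a \<mu> (\<lambda>s. f s powr \<alpha>) \<longleftrightarrow> stieltjes_rep \<rho> a \<mu> (\<lambda>s. C * G s)" for a \<mu>
      by (rule stieltjes_rep_cong) (rule C)
    have *: "stieltjes_rep (\<gamma> * \<alpha>) (C * measure m {0}) (stieltjes_measure C) (\<lambda>s. f s powr \<alpha>)"
      using stieltjes_rep_G[OF less_imp_le[OF C0]] unfolding cong[symmetric] by (simp only: \<rho>_def)
    have "no_singular_continuous_part \<mu>" if "stieltjes_rep (\<gamma> * \<alpha>) a \<mu> (\<lambda>s. f s powr \<alpha>)" for a \<mu>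
      using stieltjes_rep_unique[OF that *] no_singular_continuous_part_stieltjes_measure[OF C0] \<rho>
      by (simp add: \<rho>_def)
    with * show ?thesis by (auto simp: gen_stieltjes_def)
  qed
qed

end
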